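(* Let $n\ge 2$ be an integer, $\lambda>\frac{1}{n-1}$, $\mu>0$, and let $r\in C^2(\mathbb{R})$ be the unique solution of the problem $$\left\{\begin{aligned}&\frac{r''(y)}{1+r'(y)^2}=\frac{n-1}{r(y)}-\frac{1+r'(y)^2}{\lambda(r(y)-yr'(y))},\quad r(y)>0,\quad\forall y\in\mathbb{R},\\ &r(0)=\mu,\quad r'(0)=0.\end{aligned}\right.$$ Then $$r'(y)>0\quad\forall y>0,$$ the limit $a_1:=\lim_{y\to\infty}r'(y)$ exists and satisfies $0\le a_1<\infty$, and $$\lim_{y\to\pm\infty}r(y)=\infty.$$ Moreover there exists a constant $y_1>0$ such that $r''(y)>0$ for all $0<y<y_1$, $r''(y)<0$ for all $y>y_1$, and $r''(y_1)=0$.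
   Context: Here $r'$ and $r''$ denote the first and second derivatives with respect to $y$. Being a solution of the equation includes that the denominator $r(y)-yr'(y)$ does not vanish. For $\lambda>\frac{1}{n-1}$ and $\mu>0$ the problem has exactly one solution in $C^2(\mathbb{R})$; it is even and satisfies $r(y)>yr'(y)$ for all $y\in\mathbb{R}$. *)

theory Defs
  imports "HOL-Analysis.Analysis"
begin

definition C2_real :: "(real \<Rightarrow> real) \<Rightarrow> bool" where
  "C2_real r \<longleftrightarrow>
     r differentiable_on UNIV \<and>
     deriv r differentiable_on UNIV \<and>
     continuous_on UNIV (deriv (deriv r))"

text \<open>
  The conjunct on the denominator is the convention that a solution makes both sides of the
  equation meaningful; it has to be stated because division by zero is total here.
\<close>

definition is_solution :: "nat \<Rightarrow> real \<Rightarrow> real \<Rightarrow> (real \<Rightarrow> real) \<Rightarrow> bool" where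
  "is_solution n lam mu r \<longleftrightarrow>
     C2_real r \<and>
     (\<forall>y. r y > 0 \<and>
          r y - y * deriv r y \<noteq> 0 \<and>
          deriv (deriv r) y / (1 + (deriv r y)\<^sup>2)
            = (real n - 1) / r y
              - (1 + (deriv r y)\<^sup>2) / (lam * (r y - y * deriv r y))) \<and>
     r 0 = mu \<and> deriv r 0 = 0"

end

theory Submission
  imports Defs
begin

text \<open>
  Put \<open>k = lam * (n - 1) > 1\<close> and \<open>p y = r y - y * r' y\<close>. Since \<open>p\<close> has no zero and
  \<open>p 0 > 0\<close>, it is positive, and clearing denominators shows that \<open>r''\<close> has the sign of
  \<open>G = k * p - r * (1 + r'\<^sup>2)\<close>. At a zero of \<open>r'\<close> one has \<open>G = (k - 1) * r > 0\<close>, so \<open>r'\<close> can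
  cross zero only upwards, whence \<open>r' > 0\<close> on the positive axis. At a zero of \<open>G\<close> one has
  \<open>G' = - r' * (1 + r'\<^sup>2) < 0\<close>, so \<open>G\<close> has at most one positive zero. If it had none, then
  \<open>p\<close> would decrease and \<open>r\<close> would grow linearly, contradicting \<open>k * p > r\<close>. Beyond the zero,
  \<open>G < 0\<close> reads \<open>r' * (k * y + r * r') > (k - 1) * r\<close>, so a bounded \<open>r\<close> would
  grow at least like a positive multiple of \<open>ln y\<close>. The limit at minus infinity follows from
  the reflected solution \<open>y \<mapsto> r (- y)\<close>.
\<close>

text \<open>A first return to the value 0 after \<open>a\<close> would be reached from below,
  whereas the negative derivative there makes \<open>g\<close> positive just before it.\<close>

lemma negative_after_zero_if_downcrossing:
  fixes g g' :: "real \<Rightarrow> real"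
  assumes deriv: "\<And>x. (g has_real_derivative g' x) (at x)"
    and down: "\<And>x. a \<le> x \<Longrightarrow> g x = 0 \<Longrightarrow> g' x < 0"
    and zero: "g a = 0" and "a < y"
  shows "g y < 0"
proof (rule ccontr)
  assume "\<not> g y < 0"
  have cont: "continuous_on S g" for S
    using deriv by (meson DERIV_isCont continuous_at_imp_continuous_on)
  obtain d where d: "d > 0" "\<And>h. 0 < h \<Longrightarrow> h < d \<Longrightarrow> g (a + h) < g a"
    using DERIV_neg_dec_right[OF deriv down[OF order_refl zero]] by blast
  \<comment> \<open>Starting the search at a point where \<open>g\<close> is already negative keeps
    the zero at \<open>a\<close> itself out of \<open>S\<close>.\<close>
  define z where "z = a + min (d / 2) ((y - a) / 2)"
  have z: "a < z" "z < y" "g z < 0"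
    using d(2)[of "z - a"] d(1) \<open>a < y\<close> zero
    by (auto simp: z_def min_def field_simps split: if_splits)
  define S where "S = {z..y} \<inter> g -` {0..}"
  have "closed S"
    unfolding S_def by (intro continuous_closed_preimage cont) auto
  have S: "y \<in> S" "bdd_below S"
    using z \<open>\<not> g y < 0\<close> by (auto simp: S_def)
  define w where "w = Inf S"
  have "w \<in> S"
    using closed_contains_Inf[of S] S \<open>closed S\<close> unfolding w_def by auto
  have before: "g x < 0" if "z \<le> x" "x < w" for x
    using cInf_lower[OF _ S(2), of x] that \<open>w \<in> S\<close> unfolding w_def S_def by force
  have "z < w"
    using \<open>w \<in> S\<close> z(3) by (auto simp: S_def less_le)
  have "g w = 0"
  proof (rule ccontr)
    assume "g w \<noteq> 0"
    then have "g w > 0" using \<open>w \<in> S\<close> by (auto simp: S_def)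
    then obtain x where "z \<le> x" "x \<le> w" "g x = 0"
      using IVT'[of g z 0 w] z(3) \<open>z < w\<close> cont by auto
    then show False
      using before[of x] \<open>g w > 0\<close> by (cases "x = w") auto
  qed
  moreover have "a \<le> w" using z \<open>z < w\<close> by simp
  ultimately obtain e where e: "e > 0" "\<And>h. 0 < h \<Longrightarrow> h < e \<Longrightarrow> g (w - h) > g w"
    using DERIV_neg_dec_left[OF deriv down] by blast
  \<comment> \<open>The cap \<open>w - z\<close> keeps \<open>w - h\<close> at or above
    \<open>z\<close>, where \<open>before\<close> still applies.\<close>
  define h where "h = min (e / 2) (w - z)"
  have "g (w - h) > 0"
    using e(2)[of h] e(1) \<open>z < w\<close> \<open>g w = 0\<close> by (auto simp: h_def)
  moreover have "g (w - h) < 0"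
    by (rule before) (use e(1) \<open>z < w\<close> in \<open>auto simp: h_def\<close>)
  ultimately show False by simp
qed

text \<open>Reflection flips the signs of both \<open>y\<close> and the first derivative, so their
  product, the square of the derivative and the second derivative carry over, and with them the
  equation.\<close>

lemma is_solution_reflect:
  assumes "is_solution n lam mu r"
  shows "is_solution n lam mu (\<lambda>y. r (- y))"
proof -
  have d1: "(r has_real_derivative deriv r y) (at y)"
    and d2: "(deriv r has_real_derivative deriv (deriv r) y) (at y)" for y
    using assms
    by (auto simp: is_solution_def C2_real_def differentiable_on_def
        DERIV_deriv_iff_real_differentiable)
  have c: "continuous_on UNIV (deriv (deriv r))"
    using assms by (auto simp: is_solution_def C2_real_def)
  have r1: "((\<lambda>y. r (- y)) has_real_derivative - deriv r (- y)) (at y)" for y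
    using DERIV_chain2[OF d1 DERIV_minus[OF DERIV_ident], of y] by simp
  have e1: "deriv (\<lambda>y. r (- y)) = (\<lambda>y. - deriv r (- y))"
    using r1 DERIV_imp_deriv by blast
  have r2: "((\<lambda>y. - deriv r (- y)) has_real_derivative deriv (deriv r) (- y)) (at y)" for y
    using DERIV_minus[OF DERIV_chain2[OF d2 DERIV_minus[OF DERIV_ident], of y]] by simp
  have e2: "deriv (\<lambda>y. - deriv r (- y)) = (\<lambda>y. deriv (deriv r) (- y))"
    using r2 DERIV_imp_deriv by blast
  have "C2_real (\<lambda>y. r (- y))"
    unfolding C2_real_def e1 e2 differentiable_on_def
    using r1 r2 by (auto simp: real_differentiable_def
        intro!: continuous_on_compose2[OF c] continuous_intros)
  moreover have "r y > 0 \<and> r y - y * deriv r y \<noteq> 0 \<and>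
      deriv (deriv r) y / (1 + (deriv r y)\<^sup>2)
        = (real n - 1) / r y - (1 + (deriv r y)\<^sup>2) / (lam * (r y - y * deriv r y))" for y
    using assms by (simp add: is_solution_def)
  from this[of "- y" for y] have "r (- y) > 0 \<and> r (- y) + y * deriv r (- y) \<noteq> 0 \<and>
      deriv (deriv r) (- y) / (1 + (deriv r (- y))\<^sup>2)
        = (real n - 1) / r (- y)
          - (1 + (deriv r (- y))\<^sup>2) / (lam * (r (- y) + y * deriv r (- y)))" for y
    by simp
  ultimately show ?thesis
    using assms by (simp add: is_solution_def e1 e2)
qed

section \<open>The equation after clearing denominators\<close>

locale self_similar_profile =
  fixes n :: nat and lam mu :: real and r :: "real \<Rightarrow> real"
  assumes n: "n \<ge> 2" and lam: "lam > 1 / (real n - 1)" and mu: "mu > 0"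
    and solution: "is_solution n lam mu r"
begin

abbreviation "r' \<equiv> deriv r"
abbreviation "r'' \<equiv> deriv (deriv r)"

definition k where "k = lam * (real n - 1)"
text \<open>The height at which the tangent to the graph at \<open>y\<close> meets the vertical
  axis.\<close>

definition p where "p y = r y - y * r' y"
text \<open>The numerator of the right-hand side of the equation over the common denominator
  \<open>lam * r y * p y\<close>.\<close>

definition G where "G y = k * p y - r y * (1 + (r' y)\<^sup>2)"

lemma k_gt_1: "k > 1" and lam_pos: "lam > 0"
proof -
  have "real n - 1 > 0" using n by simp
  then show "k > 1" using lam by (simp add: k_def field_simps)
  then show "lam > 0" using \<open>real n - 1 > 0\<close> by (auto simp: k_def zero_less_mult_iff
        dest: less_trans[OF zero_less_one])
qed

lemma initial: "r 0 = mu" "r' 0 = 0" and r_pos: "r y > 0" and p_nonzero: "p y \<noteq> 0"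
  and equation: "r'' y / (1 + (r' y)\<^sup>2) = (real n - 1) / r y - (1 + (r' y)\<^sup>2) / (lam * p y)"
  using solution by (auto simp: is_solution_def p_def)

lemma DERIV_r: "(r has_real_derivative r' y) (at y)"
  and DERIV_r': "(r' has_real_derivative r'' y) (at y)"
  using solution
  by (auto simp: is_solution_def C2_real_def differentiable_on_def
      DERIV_deriv_iff_real_differentiable)

lemma DERIV_p: "(p has_real_derivative - y * r'' y) (at y)"
  unfolding p_def[abs_def]
  by (auto intro!: derivative_eq_intros DERIV_r DERIV_r')

text \<open>\<open>G\<close> contains no second derivative, so \<open>r''\<close> suffices to
  differentiate it; all terms but \<open>- r' y * (1 + (r' y)\<^sup>2)\<close> carry the factor
  \<open>r''\<close> and vanish at a zero of \<open>G\<close>.\<close>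

lemma DERIV_G:
  "(G has_real_derivative
     - k * y * r'' y - r' y * (1 + (r' y)\<^sup>2) - 2 * r y * r' y * r'' y) (at y)"
  unfolding G_def[abs_def]
  by (auto intro!: derivative_eq_intros DERIV_r DERIV_r' DERIV_p)

lemma p_pos: "p y > 0"
proof (rule ccontr)
  assume "\<not> p y > 0"
  have "continuous_on UNIV p"
    using DERIV_p by (meson DERIV_isCont continuous_at_imp_continuous_on)
  then have "connected (range p)"
    by (rule connected_continuous_image) simp
  moreover have "p 0 > 0" using mu by (simp add: p_def initial)
  ultimately have "0 \<in> range p"
    using connectedD_interval[of "range p" "p y" "p 0" 0] \<open>\<not> p y > 0\<close> by auto
  then show False using p_nonzero by (metis imageE)
qed

lemma r''_eq: "r'' y = (1 + (r' y)\<^sup>2) * G y / (lam * r y * p y)"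
proof -
  have "1 + (r' y)\<^sup>2 > 0" by (simp add: add_pos_nonneg)
  then have "r'' y = (1 + (r' y)\<^sup>2) * ((real n - 1) / r y - (1 + (r' y)\<^sup>2) / (lam * p y))"
    using equation[of y] by (simp add: divide_eq_eq mult.commute)
  also have "(real n - 1) / r y - (1 + (r' y)\<^sup>2) / (lam * p y) = G y / (lam * r y * p y)"
    using r_pos[of y] p_pos[of y] lam_pos by (simp add: G_def k_def field_simps)
  finally show ?thesis by simp
qed

lemma r''_pos_iff: "r'' y > 0 \<longleftrightarrow> G y > 0"
  and r''_neg_iff: "r'' y < 0 \<longleftrightarrow> G y < 0"
  and r''_zero_iff: "r'' y = 0 \<longleftrightarrow> G y = 0"
proof -
  define c where "c = (1 + (r' y)\<^sup>2) / (lam * r y * p y)"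
  have "c > 0" unfolding c_def
    using r_pos[of y] p_pos[of y] lam_pos by (simp add: add_pos_nonneg)
  moreover have "r'' y = c * G y" by (simp add: r''_eq c_def)
  ultimately show "r'' y > 0 \<longleftrightarrow> G y > 0" "r'' y < 0 \<longleftrightarrow> G y < 0" "r'' y = 0 \<longleftrightarrow> G y = 0"
    by (auto simp: zero_less_mult_iff mult_less_0_iff)
qed

section \<open>Monotonicity of \<open>r\<close> on the positive axis\<close>

lemma r''_pos_if_r'_zero: "r' y = 0 \<Longrightarrow> r'' y > 0"
  using r_pos[of y] k_gt_1 by (simp add: r''_pos_iff G_def p_def)

lemma r'_pos:
  assumes "y > 0"
  shows "r' y > 0"
proof -
  \<comment> \<open>\<open>- r'\<close> starts from 0 at the origin and can cross zero only
    downwards.\<close>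
  have "- r' y < 0"
    by (rule negative_after_zero_if_downcrossing[of "\<lambda>y. - r' y" "\<lambda>y. - r'' y" 0])
      (use assms in \<open>auto intro!: DERIV_minus DERIV_r' simp: initial r''_pos_if_r'_zero\<close>)
  then show ?thesis by simp
qed

lemma r_mono:
  assumes "0 \<le> x" "x \<le> y"
  shows "r x \<le> r y"
proof (rule DERIV_nonneg_imp_nondecreasing[OF assms(2)])
  fix z assume "x \<le> z" "z \<le> y"
  then have "r' z \<ge> 0" using r'_pos[of z] assms(1) initial by (cases "z = 0") auto
  then show "\<exists>D. (r has_real_derivative D) (at z) \<and> D \<ge> 0" using DERIV_r by blast
qed

section \<open>Existence and uniqueness of the inflection point\<close>

lemma G_neg_after_zero:
  assumes "y1 > 0" "G y1 = 0" "y1 < y"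
  shows "G y < 0"
proof (rule negative_after_zero_if_downcrossing[OF DERIV_G _ assms(2,3)])
  fix x assume "y1 \<le> x" "G x = 0"
  then have "r' x > 0" "r'' x = 0" using r'_pos assms(1) by (auto simp: r''_zero_iff)
  then show "- k * x * r'' x - r' x * (1 + (r' x)\<^sup>2) - 2 * r x * r' x * r'' x < 0"
    by (simp add: add_pos_nonneg)
qed

lemma continuous_G: "isCont G y"
  using DERIV_G by (rule DERIV_isCont)

text \<open>\<open>G 0 = (k - 1) * mu\<close> is positive, so the intermediate value theorem applies
  and the zero it yields is not the origin.\<close>

lemma G_zero_before_nonpos:
  assumes "x > 0" "G x \<le> 0"
  obtains w where "0 < w" "w \<le> x" "G w = 0"
proof -
  have "G 0 > 0" using mu k_gt_1 by (simp add: G_def p_def initial)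
  moreover obtain w where "0 \<le> w" "w \<le> x" "G w = 0"
    using IVT2[of G x 0 0] \<open>G 0 > 0\<close> assms continuous_G by auto
  ultimately show ?thesis using that[of w] by (cases "w = 0") auto
qed

lemma ex_G_nonpos: "\<exists>y>0. G y \<le> 0"
proof (rule ccontr)
  assume "\<not> ?thesis"
  then have pos: "G y > 0" if "y > 0" for y using that by (meson not_le)
  have r''_nonneg: "r'' y \<ge> 0" if "y \<ge> 0" for y
    using that pos[of y] r''_pos_if_r'_zero[of 0] initial r''_pos_iff[of y]
    by (cases "y = 0") auto
  have p_le: "p y \<le> mu" if "y \<ge> 0" for y
  proof -
    have "p y \<le> p 0"
      by (rule DERIV_nonpos_imp_nonincreasing[OF that])
        (rule exI, rule conjI[OF DERIV_p], simp add: r''_nonneg)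
    then show ?thesis by (simp add: p_def initial)
  qed
  have r_ge: "r y \<ge> r 1 + r' 1 * (y - 1)" if "y \<ge> 1" for y
  proof -
    have r'_ge: "r' z \<ge> r' 1" if "z \<ge> 1" for z :: real
      by (rule DERIV_nonneg_imp_nondecreasing[OF that])
        (rule exI, rule conjI[OF DERIV_r' r''_nonneg], simp)
    have "(\<lambda>y. r y - r' 1 * y) 1 \<le> (\<lambda>y. r y - r' 1 * y) y"
    proof (rule DERIV_nonneg_imp_nondecreasing[OF that])
      fix z :: real assume "1 \<le> z"
      have "((\<lambda>y. r y - r' 1 * y) has_real_derivative r' z - r' 1) (at z)"
        by (auto intro!: derivative_eq_intros DERIV_r)
      then show "\<exists>D. ((\<lambda>y. r y - r' 1 * y) has_real_derivative D) (at z) \<and> D \<ge> 0"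
        using r'_ge[OF \<open>1 \<le> z\<close>] by auto
    qed
    then show ?thesis by (simp add: algebra_simps)
  qed
  \<comment> \<open>Solves \<open>r' 1 * (y - 1) = k * mu\<close>: the linear lower bound exceeds
    \<open>k * mu\<close> here, while \<open>G y > 0\<close> and \<open>p y \<le> mu\<close> force
    \<open>r y < k * mu\<close>.\<close>
  define y where "y = 1 + k * mu / r' 1"
  have "r' 1 > 0" by (rule r'_pos) simp
  then have "y \<ge> 1" using k_gt_1 mu by (simp add: y_def)
  have "k * mu \<le> r y"
    using r_ge[OF \<open>y \<ge> 1\<close>] r_pos[of 1] \<open>r' 1 > 0\<close> by (simp add: y_def)
  also have "r y \<le> r y * (1 + (r' y)\<^sup>2)" using r_pos[of y] by simp
  also have "\<dots> < k * p y" using pos[of y] \<open>y \<ge> 1\<close> by (simp add: G_def)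
  also have "\<dots> \<le> k * mu" using p_le[of y] \<open>y \<ge> 1\<close> k_gt_1 by simp
  finally show False by simp
qed

lemma inflection_point:
  obtains y1 where "y1 > 0" "\<And>y. 0 < y \<Longrightarrow> y < y1 \<Longrightarrow> r'' y > 0"
    "\<And>y. y > y1 \<Longrightarrow> r'' y < 0" "r'' y1 = 0"
proof -
  obtain y1 where y1: "y1 > 0" "G y1 = 0"
    using ex_G_nonpos G_zero_before_nonpos by metis
  have "G y > 0" if "0 < y" "y < y1" for y
  proof (rule ccontr)
    assume "\<not> G y > 0"
    then have "G y \<le> 0" by simp
    with \<open>0 < y\<close> obtain w where "0 < w" "w \<le> y" "G w = 0"
      by (rule G_zero_before_nonpos)
    \<comment> \<open>A zero of \<open>G\<close> before \<open>y1\<close> would make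
      \<open>G\<close> negative at \<open>y1\<close>, which is itself a zero.\<close>
    then show False using G_neg_after_zero[of w y1] that y1 by simp
  qed
  then show ?thesis
    using that[OF y1(1)] G_neg_after_zero[OF y1] y1
    by (auto simp: r''_pos_iff r''_neg_iff r''_zero_iff)
qed

section \<open>Limits of \<open>r'\<close> and \<open>r\<close> at infinity\<close>

lemma r'_antimono:
  assumes "y1 \<le> x" "x \<le> y" "\<And>z. z > y1 \<Longrightarrow> r'' z < 0" "r'' y1 = 0"
  shows "r' y \<le> r' x"
proof (rule DERIV_nonpos_imp_nonincreasing[OF assms(2)])
  fix z assume "x \<le> z"
  then have "r'' z \<le> 0"
    using assms(1,4) assms(3)[of z] by (cases "z = y1") auto
  then show "\<exists>D. (r' has_real_derivative D) (at z) \<and> D \<le> 0"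
    using DERIV_r' by blast
qed

lemma r'_limit: "\<exists>a1. (r' \<longlongrightarrow> a1) at_top \<and> 0 \<le> a1"
proof -
  obtain y1 where y1: "y1 > 0" "\<And>y. y > y1 \<Longrightarrow> r'' y < 0" "r'' y1 = 0"
    using inflection_point by metis
  \<comment> \<open>Beyond \<open>y1\<close> the slope decreases and stays nonnegative, so it tends
    to its infimum there.\<close>
  define a1 where "a1 = Inf (r' ` {y1..})"
  have nonneg: "r' x \<ge> 0" if "x \<in> {y1..}" for x using r'_pos[of x] that y1 by auto
  then have bdd: "bdd_below (r' ` {y1..})" by (rule bdd_belowI2)
  have "a1 \<ge> 0" unfolding a1_def using nonneg by (intro cINF_greatest) auto
  moreover have "(r' \<longlongrightarrow> a1) at_top"
  proof (rule decreasing_tendsto)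
    show "\<forall>\<^sub>F x in at_top. a1 \<le> r' x"
      using eventually_ge_at_top[of y1]
      by eventually_elim (auto simp: a1_def intro!: cINF_lower bdd)
  next
    fix b assume "a1 < b"
    then obtain x where x: "x \<ge> y1" "r' x < b"
      unfolding a1_def using bdd by (subst (asm) cINF_less_iff) auto
    show "\<forall>\<^sub>F y in at_top. r' y < b"
      using eventually_ge_at_top[of x]
      by eventually_elim (use r'_antimono[OF x(1) _ y1(2,3)] x in force)
  qed
  ultimately show ?thesis by blast
qed

lemma r_unbounded: "\<exists>y\<ge>0. r y \<ge> M"
proof (rule ccontr)
  assume "\<not> ?thesis"
  then have r_less: "r y < M" if "y \<ge> 0" for y using that by (meson not_le)
  obtain y1 where y1: "y1 > 0" "\<And>y. y > y1 \<Longrightarrow> r'' y < 0" "r'' y1 = 0"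
    using inflection_point by metis
  \<comment> \<open>Bounds \<open>r y * r' y\<close> beyond \<open>y1\<close>, since there
    \<open>r\<close> is below \<open>M\<close> and \<open>r'\<close> is at most
    \<open>r' y1\<close>.\<close>
  define D where "D = M * r' y1"
  have "M > 0" using r_less[of 0] r_pos[of 0] by simp
  then have D: "D > 0" using r'_pos[OF y1(1)] by (simp add: D_def)
  \<comment> \<open>The value of \<open>(k - 1) * r\<close> at 0, hence its minimum on the
    nonnegative axis.\<close>
  define c where "c = (k - 1) * mu"
  have c: "c > 0" using k_gt_1 mu by (simp add: c_def)
  have r'_ge: "r' y \<ge> c / (k * y + D)" if "y > y1" for y
  proof -
    have y: "y > 0" "r' y > 0" using that y1 r'_pos by auto
    have "r y * r' y \<le> D"
      unfolding D_def using r_less[of y] r'_antimono[of y1 y1 y] y1 that y r_pos[of y]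
      by (intro mult_mono) auto
    have "c \<le> (k - 1) * r y"
      using r_mono[of 0 y] y k_gt_1 by (simp add: c_def initial)
    \<comment> \<open>This is \<open>G y < 0\<close> rearranged, with \<open>r' y\<close> factored
      out.\<close>
    also have "\<dots> \<le> r' y * (k * y + r y * r' y)"
      using y1(2)[OF that] by (simp add: r''_neg_iff G_def p_def algebra_simps power2_eq_square)
    also have "\<dots> \<le> r' y * (k * y + D)"
      using y \<open>r y * r' y \<le> D\<close> by simp
    finally show ?thesis
      using y k_gt_1 D by (simp add: divide_le_eq add_pos_pos)
  qed
  \<comment> \<open>The logarithmic term is an antiderivative of the lower bound
    \<open>c / (k * y + D)\<close> for \<open>r'\<close>, so \<open>h\<close> is nondecreasing from
    \<open>y1 + 1\<close> on.\<close>
  define h where "h y = r y - c / k * ln (k * y + D)" for y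
  have h: "h (y1 + 1) \<le> h y" if "y \<ge> y1 + 1" for y
  proof (rule DERIV_nonneg_imp_nondecreasing[OF that])
    fix z assume "y1 + 1 \<le> z"
    then have "k * z + D > 0" using y1 k_gt_1 D by (simp add: add_pos_pos)
    then have "(h has_real_derivative r' z - c / (k * z + D)) (at z)"
      unfolding h_def[abs_def] using k_gt_1
      by (auto intro!: derivative_eq_intros DERIV_r simp: divide_inverse)
    then show "\<exists>D. (h has_real_derivative D) (at z) \<and> D \<ge> 0"
      using r'_ge[of z] \<open>y1 + 1 \<le> z\<close> by auto
  qed
  have "filterlim (\<lambda>y. c / k * ln (k * y + D)) at_top at_top"
  proof (rule filterlim_tendsto_pos_mult_at_top[OF tendsto_const])
    show "c / k > 0" using c k_gt_1 by simp
    have "filterlim (\<lambda>y. D + k * y) at_top at_top"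
      using k_gt_1 by (intro filterlim_tendsto_add_at_top[OF tendsto_const]
          filterlim_tendsto_pos_mult_at_top[OF tendsto_const] filterlim_ident) auto
    then show "filterlim (\<lambda>y. ln (k * y + D)) at_top at_top"
      by (intro filterlim_compose[OF ln_at_top]) (simp add: add.commute)
  qed
  \<comment> \<open>The threshold is such that adding \<open>h (y1 + 1)\<close>, a lower bound for
    \<open>h y\<close>, gives \<open>r y \<ge> M\<close>.\<close>
  then have "\<forall>\<^sub>F y in at_top. c / k * ln (k * y + D) \<ge> M - h (y1 + 1)"
    by (simp add: filterlim_at_top)
  then have "\<forall>\<^sub>F y in at_top. c / k * ln (k * y + D) \<ge> M - h (y1 + 1) \<and> y \<ge> y1 + 1"
    using eventually_ge_at_top by (rule eventually_conj)
  then obtain y where "c / k * ln (k * y + D) \<ge> M - h (y1 + 1)" "y \<ge> y1 + 1"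
    by (auto dest: eventually_happens)
  then show False
    using h[of y] r_less[of y] y1(1) by (simp add: h_def)
qed

lemma r_at_top: "filterlim r at_top at_top"
  unfolding filterlim_at_top
proof
  fix M
  obtain x where "x \<ge> 0" "r x \<ge> M" using r_unbounded by blast
  then show "\<forall>\<^sub>F y in at_top. M \<le> r y"
    by (intro eventually_mono[OF eventually_ge_at_top[of x]]) (use r_mono in force)
qed

end

theorem theorem1p2:
  fixes n :: nat and lam mu :: real and r :: "real \<Rightarrow> real"
  assumes "n \<ge> 2" and "lam > 1 / (real n - 1)" and "mu > 0"
    and "is_solution n lam mu r"
  shows "(\<forall>y>0. deriv r y > 0)
    \<and> (\<exists>a1::real. (deriv r \<longlongrightarrow> a1) at_top \<and> 0 \<le> a1)
    \<and> filterlim r at_top at_top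
    \<and> filterlim r at_top at_bot
    \<and> (\<exists>y1>0. (\<forall>y. 0 < y \<and> y < y1 \<longrightarrow> deriv (deriv r) y > 0)
             \<and> (\<forall>y>y1. deriv (deriv r) y < 0)
             \<and> deriv (deriv r) y1 = 0)"
proof -
  interpret self_similar_profile n lam mu r
    using assms by unfold_locales
  \<comment> \<open>The growth of the reflected profile at plus infinity is that of \<open>r\<close>
    at minus infinity.\<close>
  interpret reflected: self_similar_profile n lam mu "\<lambda>y. r (- y)"
    using assms by unfold_locales (auto intro: is_solution_reflect)
  have "filterlim r at_top at_bot"
    using reflected.r_at_top by (simp add: filterlim_at_bot_mirror)
  then show ?thesis
    using r'_pos r'_limit r_at_top inflection_point by metis
qed

end
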